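(* Let $a\in\mathbb{R}^D$. Restrict sampling to a candidate subspace $U\subseteq\mathbb{R}^D$ of dimension $r$ by drawing $\delta=\rho u$ with $u$ uniform on the unit sphere of $U$ (fixed $\rho$). Then $$\mathbb{E}[a^\top\delta]=0\qquad\text{and}\qquad\operatorname{Var}(a^\top\delta)=\frac{\rho^2\|P_U a\|^2}{r}.$$ Therefore, the per-dimension search signal scales as $\|P_U a\|/\sqrt{r}$: adding to $U$ directions orthogonal to $a$ raises $r$ without raising $\|P_U a\|$, and so lowers the signal.
   Context: $a$ is a fixed vector, called the useful direction: $a=-\nabla L(\theta)$ for a task loss $L$ at a parameter vector $\theta\in\mathbb{R}^D$. $U$ is a linear subspace chosen by the experimenter, and $P_U$ is the orthogonal projection onto $U$. $\|\cdot\|$ is the Euclidean norm. The unit sphere of $U$ is $\{u\in U:\|u\|=1\}$ with its uniform (rotation-invariant) probability measure.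
   Formalization: The added directions are assumed orthogonal to P_U a as well as to a (otherwise ‖P_U a‖ can rise), and not all already in U; the signal is claimed to drop strictly only when P_U a ≠ 0 and ρ ≠ 0. *)

theory Defs
  imports "HOL-Probability.Probability"
begin

definition orth_proj :: "(real^'n) set \<Rightarrow> real^'n \<Rightarrow> real^'n" where
  "orth_proj U x = (THE y. y \<in> U \<and> (\<forall>w\<in>U. orthogonal (x - y) w))"

lemma orth_proj_unique:
  assumes "subspace U" "y \<in> U" "\<forall>w\<in>U. orthogonal (x - y) w"
  shows "orth_proj U x = y"
  unfolding orth_proj_def
proof (rule the_equality)
  fix z assume z: "z \<in> U \<and> (\<forall>w\<in>U. orthogonal (x - z) w)"
  have m: "y - z \<in> U" using assms z subspace_diff by blast
  have "orthogonal ((x - z) - (x - y)) (y - z)"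
    using m z assms by (simp add: orthogonal_def inner_diff_left)
  then show "z = y" by (simp add: orthogonal_def)
qed (use assms in auto)

lemma orth_proj_props:
  assumes "subspace U"
  shows "orth_proj U x \<in> U" and "\<And>w. w \<in> U \<Longrightarrow> orthogonal (x - orth_proj U x) w"
proof -
  obtain y z where yz: "y \<in> span U" "\<And>w. w \<in> span U \<Longrightarrow> orthogonal z w" "x = y + z"
    using orthogonal_subspace_decomp_exists[of U x] by blast
  have "span U = U" using assms by (simp add: span_eq_iff)
  then have "orth_proj U x = y" using yz \<open>span U = U\<close> by (intro orth_proj_unique[OF assms]) auto
  then show "orth_proj U x \<in> U" "\<And>w. w \<in> U \<Longrightarrow> orthogonal (x - orth_proj U x) w"
    using yz \<open>span U = U\<close> by auto
qed

lemma linear_orth_proj: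
  assumes "subspace U"
  shows "linear (orth_proj U)"
proof (rule linearI)
  note p = orth_proj_props[OF assms]
  fix x y c
  show "orth_proj U (x + y) = orth_proj U x + orth_proj U y"
  proof (rule orth_proj_unique[OF assms])
    show "orth_proj U x + orth_proj U y \<in> U" by (intro subspace_add[OF assms] p(1))
    show "\<forall>w\<in>U. orthogonal (x + y - (orth_proj U x + orth_proj U y)) w"
      using orthogonal_clauses(9)[OF p(2) p(2)] by (simp add: add_diff_add)
  qed
  show "orth_proj U (c *\<^sub>R x) = c *\<^sub>R orth_proj U x"
  proof (rule orth_proj_unique[OF assms])
    show "c *\<^sub>R orth_proj U x \<in> U" by (intro subspace_scale[OF assms] p(1))
    show "\<forall>w\<in>U. orthogonal (c *\<^sub>R x - c *\<^sub>R orth_proj U x) w"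
      using orthogonal_clauses(7)[OF p(2)] by (simp add: scaleR_diff_right[symmetric])
  qed
qed

text \<open>
  Rotation invariance is with respect to the full orthogonal group of \<open>U\<close>, whose elements are
  exactly the restrictions to \<open>U\<close> of orthogonal maps of the ambient space that preserve \<open>U\<close>.
  Proper rotations alone would not single out the uniform measure when \<open>dim U = 1\<close>.
  The full group acts transitively on the unit sphere of \<open>U\<close>, so at most one measure satisfies
  this predicate; one exists as soon as \<open>U \<noteq> {0}\<close> (\<open>uniform_on_unit_sphere_exists\<close> below).
\<close>

definition uniform_on_unit_sphere :: "(real^'n) set \<Rightarrow> (real^'n) measure \<Rightarrow> bool" where
  "uniform_on_unit_sphere U \<mu> \<longleftrightarrow>
     prob_space \<mu> \<and> sets \<mu> = sets borel \<and>
     (AE u in \<mu>. u \<in> U \<and> norm u = 1) \<and>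
     (\<forall>f. orthogonal_transformation f \<and> f ` U = U \<longrightarrow> distr \<mu> borel f = \<mu>)"

lemma orth_proj_commute:
  assumes "subspace U" "orthogonal_transformation f" "f ` U = U"
  shows "orth_proj U (f x) = f (orth_proj U x)"
proof (rule orth_proj_unique[OF assms(1)])
  show "f (orth_proj U x) \<in> U" using orth_proj_props(1)[OF assms(1)] assms(3) by blast
  show "\<forall>w\<in>U. orthogonal (f x - f (orth_proj U x)) w"
  proof
    fix w assume "w \<in> U"
    then obtain v where v: "v \<in> U" "w = f v" using assms(3) by blast
    have "f x - f (orth_proj U x) = f (x - orth_proj U x)"
      using assms(2) by (simp add: orthogonal_transformation_linear linear_diff)
    then show "orthogonal (f x - f (orth_proj U x)) w"
      using orth_proj_props(2)[OF assms(1) v(1), of x] assms(2) v(2)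
      by (simp add: orthogonal_def orthogonal_transformation_def)
  qed
qed

lemma emeasure_lborel_orthogonal_image_le:
  fixes f :: "'a::euclidean_space \<Rightarrow> 'a"
  assumes f: "orthogonal_transformation f" and S: "open S"
  shows "emeasure lborel S \<le> emeasure lborel (f ` S)"
proof -
  let ?K = "{(x::'a, r::real). 0 < r \<and> ball x r \<subseteq> S}"
  let ?b = "\<lambda>p::'a \<times> real. ball (fst p) (snd p)"
  have "\<exists>i. i \<in> ?K \<and> x \<in> ?b i \<and> snd i < d" if x: "x \<in> S" "0 < d" for x d
  proof -
    obtain e where e: "e > 0" "ball x e \<subseteq> S" using S x(1) openE by blast
    have "ball x (min e (d/2)) \<subseteq> S" using e(2) by auto
    then show ?thesis using e(1) x(2) by (intro exI[of _ "(x, min e (d/2))"]) auto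
  qed
  then obtain C where C: "countable C" "C \<subseteq> ?K" "pairwise (\<lambda>i j. disjnt (?b i) (?b j)) C"
    and neg: "negligible (S - (\<Union>i\<in>C. ?b i))"
    using Vitali_covering_theorem_balls[of S ?K fst snd] by blast
  let ?V = "\<Union>i\<in>C. ?b i"
  have VS: "?V \<subseteq> S" using C(2) by fastforce
  have V: "open ?V" by auto
  have imV: "f ` ?V = (\<Union>i\<in>C. f ` ?b i)" by blast
  have fb: "f ` ?b i = ball (f (fst i)) (snd i)" for i
    by (rule image_orthogonal_transformation_ball[OF f])
  have dj: "disjoint_family_on ?b C"
    using C(3) unfolding disjoint_family_on_def pairwise_def disjnt_def by blast
  have inj: "inj f" by (rule orthogonal_transformation_inj[OF f])
  have dj': "disjoint_family_on (\<lambda>i. f ` ?b i) C"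
    using dj unfolding disjoint_family_on_def image_Int[OF inj, symmetric] by simp
  have fS: "open (f ` S)"
  proof -
    have "linear f" by (rule orthogonal_transformation_linear[OF f])
    then show ?thesis using open_surjective_linear_image[OF S] orthogonal_transformation_surj[OF f] by blast
  qed
  have N: "S - ?V \<in> null_sets lborel"
  proof -
    have "S - ?V \<in> sets lborel" using S V by (simp add: borel_open sets.Diff)
    with neg show ?thesis
      unfolding negligible_iff_null_sets by (simp add: null_sets_completion_iff)
  qed
  have "emeasure lborel S = emeasure lborel (?V \<union> (S - ?V))" using VS by (simp add: Un_absorb1)
  also have "\<dots> = emeasure lborel ?V" using N V by (intro emeasure_Un_null_set) auto
  also have "\<dots> = (\<integral>\<^sup>+i. emeasure lborel (?b i) \<partial>count_space C)"
    using dj by (intro emeasure_UN_countable) (auto simp: C(1))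
  also have "\<dots> = (\<integral>\<^sup>+i. emeasure lborel (f ` ?b i) \<partial>count_space C)"
  proof (rule nn_integral_cong)
    fix i assume "i \<in> space (count_space C)"
    then have "0 \<le> snd i" using C(2) by fastforce
    then show "emeasure lborel (?b i) = emeasure lborel (f ` ?b i)" unfolding fb
      by (simp add: emeasure_ball)
  qed
  also have "\<dots> = emeasure lborel (f ` ?V)" unfolding imV
    using dj' by (intro emeasure_UN_countable[symmetric]) (auto simp: C(1) fb)
  also have "\<dots> \<le> emeasure lborel (f ` S)" using VS fS by (intro emeasure_mono) auto
  finally show ?thesis .
qed

lemma emeasure_lborel_orthogonal_vimage:
  fixes f :: "'a::euclidean_space \<Rightarrow> 'a"
  assumes f: "orthogonal_transformation f" and S: "open S"
  shows "emeasure lborel (f -` S) = emeasure lborel S"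
proof (rule antisym)
  have g: "orthogonal_transformation (inv f)" using f by (rule orthogonal_transformation_inv)
  have eq: "f -` S = inv f ` S"
    using bij_vimage_eq_inv_image[OF orthogonal_transformation_bij[OF f]] by blast
  have "continuous_on UNIV f"
    using f by (intro linear_continuous_on) (simp add: orthogonal_transformation_linear linear_linear)
  then have "open (f -` S)" using S by (simp add: open_vimage)
  then have "emeasure lborel (f -` S) \<le> emeasure lborel (f ` (f -` S))"
    by (rule emeasure_lborel_orthogonal_image_le[OF f])
  then show "emeasure lborel (f -` S) \<le> emeasure lborel S"
    by (simp add: orthogonal_transformation_surj[OF f] surj_image_vimage_eq)
  show "emeasure lborel S \<le> emeasure lborel (f -` S)"
    unfolding eq by (rule emeasure_lborel_orthogonal_image_le[OF g S])
qed

lemma uniform_on_unit_sphere_exists: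
  fixes U :: "(real^'n) set"
  assumes U: "subspace U" "U \<noteq> {0}"
  shows "\<exists>\<mu>. uniform_on_unit_sphere U \<mu>"
proof -
  let ?B = "ball (0::real^'n) 1"
  let ?N = "uniform_measure lborel ?B"
  let ?s = "\<lambda>x. sgn (orth_proj U x)"
  let ?M = "distr ?N borel ?s"
  note lin = linear_orth_proj[OF U(1)]
  have pm [measurable]: "orth_proj U \<in> borel_measurable borel"
    using lin by (intro borel_measurable_continuous_onI linear_continuous_on) (simp add: linear_linear)
  have sm: "?s \<in> measurable ?N borel" by measurable
  have B0: "emeasure lborel ?B \<noteq> 0"
    using negligible_iff_emeasure0[of ?B] open_not_negligible[of ?B] by auto
  have Bf: "emeasure lborel ?B \<noteq> \<infinity>" using emeasure_lborel_ball_finite[of "0::real^'n" 1] by (metis infinity_ennreal_def less_irrefl)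
  have pN: "prob_space ?N" by (rule prob_space_uniform_measure[OF B0 Bf])
  have pM: "prob_space ?M" by (rule prob_space.prob_space_distr[OF pN sm])
  let ?K = "{x. orth_proj U x = 0}"
  have subK: "subspace ?K" by (rule linear_subspace_kernel[OF lin])
  have "?K \<noteq> UNIV"
  proof
    assume K: "?K = UNIV"
    obtain v where v: "v \<in> U" "v \<noteq> 0" using U subspace_0[OF U(1)] by blast
    have "orth_proj U v = v" using v by (intro orth_proj_unique[OF U(1)]) (auto simp: orthogonal_def)
    moreover have "orth_proj U v = 0" using K by blast
    ultimately show False using v by simp
  qed
  then have "dim ?K < DIM(real^'n)"
    using subK by (metis dim_eq_full dim_subset_UNIV order_le_less span_eq_iff)
  then have negK: "negligible ?K" by (rule negligible_lowdim)
  have Kb: "?K \<in> sets borel" by measurable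
  have "?K \<in> null_sets lborel"
    using negK Kb negligible_iff_emeasure0[of ?K] by (auto simp: null_sets_def)
  then have "AE x in lborel. orth_proj U x \<noteq> 0" by (rule AE_I'[where P="\<lambda>x. orth_proj U x \<noteq> 0"]) auto
  then have "AE x in ?N. orth_proj U x \<noteq> 0"
    by (intro AE_uniform_measureI) auto
  then have "AE x in ?N. ?s x \<in> U \<and> norm (?s x) = 1"
    by eventually_elim (auto simp: sgn_div_norm subspace_scale[OF U(1)] orth_proj_props(1)[OF U(1)])
  moreover have "U \<in> sets borel" using closed_subspace[OF U(1)] by (rule borel_closed)
  ultimately have ae: "AE u in ?M. u \<in> U \<and> norm u = 1"
    by (subst AE_distr_iff[OF sm]) auto
  have inv: "distr ?M borel f = ?M" if f: "orthogonal_transformation f" "f ` U = U" for f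
  proof -
    have fm [measurable]: "f \<in> borel_measurable borel"
      using f by (intro borel_measurable_continuous_onI linear_continuous_on)
        (simp add: orthogonal_transformation_linear linear_linear)
    have Nf: "distr ?N borel f = ?N"
    proof (rule measure_eqI_generator_eq[where E="{S. open S}" and \<Omega>=UNIV and A="\<lambda>_. UNIV"])
      fix A :: "(real^'n) set" assume "A \<in> {S. open S}"
      then have A: "open A" by simp
      then have Ab: "A \<in> sets borel" by simp
      have "emeasure (distr ?N borel f) A = emeasure ?N (f -` A)"
        using Ab by (subst emeasure_distr) auto
      also have "\<dots> = emeasure lborel (?B \<inter> f -` A) / emeasure lborel ?B"
        using measurable_sets[OF fm Ab] by (subst emeasure_uniform_measure) auto
      also have "?B \<inter> f -` A = f -` (?B \<inter> A)"
        using f(1) by (auto simp: orthogonal_transformation_norm)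
      also have "emeasure lborel \<dots> = emeasure lborel (?B \<inter> A)"
        using A by (intro emeasure_lborel_orthogonal_vimage[OF f(1)]) auto
      also have "\<dots> / emeasure lborel ?B = emeasure ?N A"
        using Ab by (subst emeasure_uniform_measure) auto
      finally show "emeasure (distr ?N borel f) A = emeasure ?N A" .
    next
      fix i :: nat
      have "prob_space (distr ?N borel f)"
        by (rule prob_space.prob_space_distr[OF pN]) simp
      from prob_space.emeasure_space_1[OF this]
      show "emeasure (distr ?N borel f) UNIV \<noteq> \<infinity>" by simp
    qed (auto simp: Int_stable_def borel_def)
    have c: "f \<circ> ?s = ?s \<circ> f"
      using f by (auto simp: fun_eq_iff orth_proj_commute[OF U(1) f] sgn_div_norm
          orthogonal_transformation_norm linear_scale orthogonal_transformation_linear)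
    have "distr ?M borel f = distr ?N borel (f \<circ> ?s)" by (rule distr_distr) auto
    also have "\<dots> = distr (distr ?N borel f) borel ?s"
      unfolding c by (rule distr_distr[symmetric]) auto
    finally show ?thesis unfolding Nf .
  qed
  show ?thesis unfolding uniform_on_unit_sphere_def
    using pM ae inv by (intro exI[of _ ?M]) auto
qed

end

theory Submission
  imports Defs
begin

text \<open>
  Let \<open>\<mu>\<close> be the uniform measure. Invariance under \<open>u \<mapsto> -u\<close> makes the mean of \<open>b \<bullet> u\<close> vanish.
  Any two vectors of \<open>U\<close> of equal length are exchanged by a reflection in \<open>U\<close>, so the second
  moment \<open>q b\<close> of \<open>b \<bullet> u\<close> depends only on the length of \<open>b \<in> U\<close>. Summing \<open>q\<close> over an
  orthonormal basis of \<open>U\<close> scaled by the length of \<open>b\<close>, Parseval gives \<open>r * q b = (norm b)\<^sup>2\<close>.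
  Finally \<open>a \<bullet> u = P\<^sub>U a \<bullet> u\<close> for \<open>u \<in> U\<close>.
\<close>

section \<open>Reflections and orthonormal expansions\<close>

lemma reflection_orthogonal_transformation:
  fixes v :: "'a::euclidean_space"
  shows "orthogonal_transformation (\<lambda>x. x - (2 * (x \<bullet> v) / (v \<bullet> v)) *\<^sub>R v)"
  unfolding orthogonal_transformation_def
proof (intro conjI allI linearI)
  fix x y :: 'a
  \<comment> \<open>For \<open>v = 0\<close> the quotient is 0 by convention and the map is the
    identity, so no hypothesis on \<open>v\<close> is required.\<close>
  show "(x - (2 * (x \<bullet> v) / (v \<bullet> v)) *\<^sub>R v) \<bullet> (y - (2 * (y \<bullet> v) / (v \<bullet> v)) *\<^sub>R v) = x \<bullet> y"
    by (cases "v = 0") (simp_all add: inner_diff_left inner_diff_right inner_commute)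
qed (simp_all add: inner_add_left add_divide_distrib distrib_left scaleR_add_left scaleR_diff_right)

lemma involution_image_eq:
  assumes "\<And>x. x \<in> A \<Longrightarrow> f x \<in> A" and "\<And>x. f (f x) = x"
  shows "f ` A = A"
  using assms by (metis image_iff image_subsetI subsetI subset_antisym)

text \<open>The map is the reflection in the hyperplane orthogonal to \<open>b - c\<close>. It
  preserves \<open>U\<close> because \<open>b - c\<close> lies in \<open>U\<close>; for
  \<open>b = c\<close> it is the identity. The last conclusion, obtained from
  \<open>c = f b\<close>, is the form in which a change of variables replaces \<open>c\<close> by
  \<open>b\<close>.\<close>

lemma reflection_exchanging:
  fixes b c :: "'a::euclidean_space"
  assumes U: "subspace U" and b: "b \<in> U" and c: "c \<in> U" and n: "norm b = norm c"
  obtains f where "orthogonal_transformation f" "f ` U = U" "f b = c"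
    "\<And>x. c \<bullet> f x = b \<bullet> x"
proof -
  define v where "v = b - c"
  define f where "f = (\<lambda>x. x - (2 * (x \<bullet> v) / (v \<bullet> v)) *\<^sub>R v)"
  have f: "orthogonal_transformation f"
    unfolding f_def by (rule reflection_orthogonal_transformation)
  have "f ` U = U"
  proof (rule involution_image_eq)
    have "v \<in> U" unfolding v_def using U b c by (rule subspace_diff)
    then show "f x \<in> U" if "x \<in> U" for x
      unfolding f_def using U that by (intro subspace_diff subspace_scale)
    show "f (f x) = x" for x
      by (cases "v = 0") (simp_all add: f_def inner_diff_left flip: scaleR_left_diff_distrib scaleR_left_distrib)
  qed
  have "b \<bullet> b = c \<bullet> c" using n by (simp add: dot_square_norm)
  \<comment> \<open>Equal lengths make the coefficient of \<open>v\<close> in \<open>f b\<close>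
    equal to 1 when \<open>v\<close> is nonzero, so that \<open>f b = b - v = c\<close>.\<close>
  then have "v \<bullet> v = 2 * (b \<bullet> v)"
    by (simp add: v_def inner_diff_left inner_diff_right inner_commute)
  then have fb: "f b = c" by (cases "v = 0") (auto simp: f_def v_def)
  then have "c \<bullet> f x = b \<bullet> x" for x
    using f by (metis orthogonal_transformation_def)
  with f \<open>f ` U = U\<close> fb show thesis by (rule that)
qed

lemma orthonormal_parseval:
  fixes x :: "'a::euclidean_space"
  assumes B: "pairwise orthogonal B" "\<And>e. e \<in> B \<Longrightarrow> norm e = 1" "finite B" and x: "x \<in> span B"
  shows "(\<Sum>e\<in>B. (e \<bullet> x)\<^sup>2) = (norm x)\<^sup>2"
proof -
  have "(norm x)\<^sup>2 = (norm (\<Sum>e\<in>B. (x \<bullet> e) *\<^sub>R e))\<^sup>2"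
    using orthonormal_basis_expand[OF B(1,2) x B(3)] by simp
  also have "\<dots> = (\<Sum>e\<in>B. (norm ((x \<bullet> e) *\<^sub>R e))\<^sup>2)"
    using B(1,3) by (intro norm_sum_Pythagorean) (auto simp: pairwise_def orthogonal_def)
  also have "\<dots> = (\<Sum>e\<in>B. (e \<bullet> x)\<^sup>2)"
    using B(2) by (intro sum.cong) (auto simp: inner_commute power_mult_distrib)
  finally show ?thesis by simp
qed

section \<open>Moments of the uniform measure on the sphere\<close>

lemma uniform_on_unit_sphere_integrable:
  assumes "uniform_on_unit_sphere U \<mu>"
  shows "integrable \<mu> (\<lambda>x. b \<bullet> x)" and "integrable \<mu> (\<lambda>x. (b \<bullet> x)\<^sup>2)"
proof -
  note \<mu> = assms[unfolded uniform_on_unit_sphere_def]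
  interpret prob_space \<mu> using \<mu> by simp
  have [measurable_cong]: "sets \<mu> = sets borel" using \<mu> by simp
  have ae: "AE x in \<mu>. x \<in> U \<and> norm x = 1" using \<mu> by simp
  \<comment> \<open>Cauchy-Schwarz on unit vectors gives an almost sure bound. Integrability gives
    the moments content, since the Bochner integral of a non-integrable function is 0 by
    default.\<close>
  have bd: "AE x in \<mu>. \<bar>b \<bullet> x\<bar> \<le> norm b"
    using ae
  proof eventually_elim
    case (elim x)
    then show ?case using Cauchy_Schwarz_ineq2[of b x] by simp
  qed
  show "integrable \<mu> (\<lambda>x. b \<bullet> x)"
    using bd by (intro integrable_const_bound[where B="norm b"]) auto
  have "AE x in \<mu>. norm ((b \<bullet> x)\<^sup>2) \<le> (norm b)\<^sup>2"
    using bd by eventually_elim (metis abs_ge_zero norm_power power_mono real_norm_def)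
  then show "integrable \<mu> (\<lambda>x. (b \<bullet> x)\<^sup>2)"
    by (intro integrable_const_bound[where B="(norm b)\<^sup>2"]) auto
qed

lemma uniform_on_unit_sphere_integral_invariant:
  fixes g :: "real^'n \<Rightarrow> real"
  assumes "uniform_on_unit_sphere U \<mu>" and f: "orthogonal_transformation f" "f ` U = U"
    and g: "g \<in> borel_measurable borel"
  shows "(\<integral>x. g (f x) \<partial>\<mu>) = (\<integral>x. g x \<partial>\<mu>)"
proof -
  note \<mu> = assms(1)[unfolded uniform_on_unit_sphere_def]
  have [measurable_cong]: "sets \<mu> = sets borel" using \<mu> by simp
  have "f \<in> borel_measurable borel"
    using f(1) by (intro borel_measurable_continuous_onI linear_continuous_on)
      (simp add: orthogonal_transformation_linear linear_linear)
  then have fm: "f \<in> \<mu> \<rightarrow>\<^sub>M borel" by measurable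
  have "(\<integral>x. g x \<partial>\<mu>) = (\<integral>x. g x \<partial>(distr \<mu> borel f))" using \<mu> f by simp
  also have "\<dots> = (\<integral>x. g (f x) \<partial>\<mu>)" by (rule integral_distr[OF fm g])
  finally show ?thesis by simp
qed

lemma uniform_on_unit_sphere_mean:
  assumes U: "subspace U" and \<mu>: "uniform_on_unit_sphere U \<mu>"
  shows "(\<integral>x. b \<bullet> x \<partial>\<mu>) = 0"
proof -
  have "orthogonal_transformation (uminus :: real^'n \<Rightarrow> _)"
    by (simp add: orthogonal_transformation_def linear_iff)
  moreover have "uminus ` U = U"
    by (rule involution_image_eq) (use U in \<open>auto simp: subspace_neg\<close>)
  ultimately have "(\<integral>x. b \<bullet> (- x) \<partial>\<mu>) = (\<integral>x. b \<bullet> x \<partial>\<mu>)"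
    by (rule uniform_on_unit_sphere_integral_invariant[OF \<mu>]) simp
  then show ?thesis by simp
qed

text \<open>The product form avoids dividing by the dimension until it is known to be positive.
  Membership of \<open>b\<close> in \<open>U\<close> allows a reflection preserving \<open>U\<close>
  to carry \<open>b\<close> to any vector of \<open>U\<close> of the same length.\<close>

lemma uniform_on_unit_sphere_second_moment_mult:
  assumes U: "subspace U" and \<mu>: "uniform_on_unit_sphere U \<mu>" and b: "b \<in> U"
  shows "real (dim U) * (\<integral>x. (b \<bullet> x)\<^sup>2 \<partial>\<mu>) = (norm b)\<^sup>2"
proof -
  obtain B where B: "B \<subseteq> U" "pairwise orthogonal B" "\<And>e. e \<in> B \<Longrightarrow> norm e = 1"
    "independent B" "card B = dim U" "span B = U"
    using orthonormal_basis_subspace[OF U] by blast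
  have fin: "finite B" using B(4) by (rule finiteI_independent)
  interpret prob_space \<mu> using \<mu> by (simp add: uniform_on_unit_sphere_def)
  have ae: "AE x in \<mu>. x \<in> U \<and> norm x = 1" using \<mu> by (simp add: uniform_on_unit_sphere_def)
  have eq: "(\<integral>x. ((norm b *\<^sub>R e) \<bullet> x)\<^sup>2 \<partial>\<mu>) = (\<integral>x. (b \<bullet> x)\<^sup>2 \<partial>\<mu>)" if e: "e \<in> B" for e
  proof -
    have "norm b *\<^sub>R e \<in> U" "norm b = norm (norm b *\<^sub>R e)"
      using e B(1,3) U by (auto simp: subspace_scale)
    then obtain f where f: "orthogonal_transformation f" "f ` U = U"
      and fc: "\<And>x. (norm b *\<^sub>R e) \<bullet> f x = b \<bullet> x"
      using reflection_exchanging[OF U b] by metis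
    show ?thesis
      using uniform_on_unit_sphere_integral_invariant[OF \<mu> f, of "\<lambda>x. ((norm b *\<^sub>R e) \<bullet> x)\<^sup>2"]
      unfolding fc by simp
  qed
  have "real (dim U) * (\<integral>x. (b \<bullet> x)\<^sup>2 \<partial>\<mu>) = (\<Sum>e\<in>B. \<integral>x. ((norm b *\<^sub>R e) \<bullet> x)\<^sup>2 \<partial>\<mu>)"
    using eq B(5) by simp
  also have "\<dots> = (\<integral>x. (\<Sum>e\<in>B. ((norm b *\<^sub>R e) \<bullet> x)\<^sup>2) \<partial>\<mu>)"
    by (rule Bochner_Integration.integral_sum[symmetric])
      (rule uniform_on_unit_sphere_integrable[OF \<mu>])
  also have "\<dots> = (\<integral>x. (norm b)\<^sup>2 \<partial>\<mu>)"
  proof (rule integral_cong_AE)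
    have [measurable_cong]: "sets \<mu> = sets borel"
      using \<mu> by (simp add: uniform_on_unit_sphere_def)
    show "(\<lambda>x. \<Sum>e\<in>B. ((norm b *\<^sub>R e) \<bullet> x)\<^sup>2) \<in> borel_measurable \<mu>" by measurable
    show "AE x in \<mu>. (\<Sum>e\<in>B. ((norm b *\<^sub>R e) \<bullet> x)\<^sup>2) = (norm b)\<^sup>2"
      using ae
    proof eventually_elim
      \<comment> \<open>On the sphere, Parseval turns the sum over the basis into the squared length
        of \<open>x\<close>, which is 1; the integrand is thus almost surely constant.\<close>
      case (elim x)
      then have "(\<Sum>e\<in>B. (e \<bullet> x)\<^sup>2) = 1"
        using orthonormal_parseval[OF B(2,3) fin, of x] B(6) by simp
      then show ?case by (simp add: power_mult_distrib flip: sum_distrib_left)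
    qed
  qed simp
  also have "\<dots> = (norm b)\<^sup>2" by (simp add: prob_space)
  finally show ?thesis .
qed

text \<open>The unit sphere of the zero subspace is empty and cannot carry a probability measure.
  Division by the dimension is therefore legitimate whenever a uniform sample exists.\<close>

lemma uniform_on_unit_sphere_dim_pos:
  assumes "uniform_on_unit_sphere U \<mu>"
  shows "0 < dim U"
proof (rule ccontr)
  interpret prob_space \<mu> using assms by (simp add: uniform_on_unit_sphere_def)
  assume "\<not> 0 < dim U"
  then have U0: "U \<subseteq> {0}" by simp
  have "AE x in \<mu>. x \<in> U \<and> norm x = 1"
    using assms by (simp add: uniform_on_unit_sphere_def)
  then have "AE x in \<mu>. False"
  proof eventually_elim
    case (elim x)
    then show ?case using U0 by auto
  qed
  then show False by simp
qed

text \<open>The component of \<open>a\<close> orthogonal to \<open>U\<close> is invisible to vectors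
  of \<open>U\<close>, which reduces the claim to a vector inside \<open>U\<close>.\<close>

lemma uniform_on_unit_sphere_second_moment:
  assumes U: "subspace U" and \<mu>: "uniform_on_unit_sphere U \<mu>"
  shows "(\<integral>x. (a \<bullet> x)\<^sup>2 \<partial>\<mu>) = (norm (orth_proj U a))\<^sup>2 / real (dim U)"
proof -
  have [measurable_cong]: "sets \<mu> = sets borel"
    using \<mu> by (simp add: uniform_on_unit_sphere_def)
  have "AE x in \<mu>. x \<in> U" using \<mu> by (auto simp: uniform_on_unit_sphere_def)
  then have "AE x in \<mu>. (a \<bullet> x)\<^sup>2 = (orth_proj U a \<bullet> x)\<^sup>2"
    by eventually_elim
      (use orth_proj_props(2)[OF U, of _ a] in \<open>simp add: orthogonal_def inner_diff_left\<close>)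
  then have "(\<integral>x. (a \<bullet> x)\<^sup>2 \<partial>\<mu>) = (\<integral>x. (orth_proj U a \<bullet> x)\<^sup>2 \<partial>\<mu>)"
    by (intro integral_cong_AE) auto
  then show ?thesis
    using uniform_on_unit_sphere_second_moment_mult[OF U \<mu> orth_proj_props(1)[OF U, of a]]
      uniform_on_unit_sphere_dim_pos[OF \<mu>]
    by (metis less_not_refl mult.commute nonzero_eq_divide_eq of_nat_eq_0_iff)
qed

section \<open>Sampled directions and enlarged subspaces\<close>

lemma sphere_sample_moments:
  fixes M :: "'s measure" and u :: "'s \<Rightarrow> real^'n"
  assumes U: "subspace U" and u [measurable]: "u \<in> borel_measurable M"
    and \<mu>: "uniform_on_unit_sphere U (distr M borel u)"
  shows "integrable M (\<lambda>\<omega>. a \<bullet> (\<rho> *\<^sub>R u \<omega>))"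
    and "integrable M (\<lambda>\<omega>. (a \<bullet> (\<rho> *\<^sub>R u \<omega>))\<^sup>2)"
    and "(\<integral>\<omega>. a \<bullet> (\<rho> *\<^sub>R u \<omega>) \<partial>M) = 0"
    and "(\<integral>\<omega>. (a \<bullet> (\<rho> *\<^sub>R u \<omega>) - (\<integral>\<omega>. a \<bullet> (\<rho> *\<^sub>R u \<omega>) \<partial>M))\<^sup>2 \<partial>M)
           = \<rho>\<^sup>2 * (norm (orth_proj U a))\<^sup>2 / real (dim U)"
proof -
  \<comment> \<open>The radius is moved from the sample onto \<open>a\<close>, so the facts about
    unit vectors apply directly.\<close>
  note int = uniform_on_unit_sphere_integrable[OF \<mu>, of "\<rho> *\<^sub>R a"]
  show "integrable M (\<lambda>\<omega>. a \<bullet> (\<rho> *\<^sub>R u \<omega>))"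
    using integrable_distr[OF u int(1)] by simp
  show "integrable M (\<lambda>\<omega>. (a \<bullet> (\<rho> *\<^sub>R u \<omega>))\<^sup>2)"
    using integrable_distr[OF u int(2)] by simp
  have m: "(\<integral>\<omega>. a \<bullet> u \<omega> \<partial>M) = 0"
    using uniform_on_unit_sphere_mean[OF U \<mu>, of a] by (subst (asm) integral_distr) auto
  then show 0: "(\<integral>\<omega>. a \<bullet> (\<rho> *\<^sub>R u \<omega>) \<partial>M) = 0" by simp
  have "(\<integral>\<omega>. (a \<bullet> u \<omega>)\<^sup>2 \<partial>M) = (norm (orth_proj U a))\<^sup>2 / real (dim U)"
    using uniform_on_unit_sphere_second_moment[OF U \<mu>, of a] by (subst (asm) integral_distr) auto
  \<comment> \<open>As the mean vanishes, the variance is the second moment.\<close>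
  then show "(\<integral>\<omega>. (a \<bullet> (\<rho> *\<^sub>R u \<omega>) - (\<integral>\<omega>. a \<bullet> (\<rho> *\<^sub>R u \<omega>) \<partial>M))\<^sup>2 \<partial>M)
           = \<rho>\<^sup>2 * (norm (orth_proj U a))\<^sup>2 / real (dim U)"
    unfolding 0 by (simp add: power_mult_distrib)
qed

text \<open>The residual \<open>a - orth_proj U a\<close> is orthogonal to \<open>U\<close> and to
  \<open>W\<close>, hence to their span. Orthogonality of \<open>W\<close> to \<open>a\<close> alone
  would not do: with \<open>U\<close> spanned by e1, a = e1 + e2 and w = e1 - e2, the projection
  grows from e1 to all of \<open>a\<close>.\<close>

lemma orth_proj_span_Un:
  assumes U: "subspace U"
    and W: "\<And>w. w \<in> W \<Longrightarrow> orthogonal w a \<and> orthogonal w (orth_proj U a)"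
  shows "orth_proj (span (U \<union> W)) a = orth_proj U a"
proof (rule orth_proj_unique[OF subspace_span], safe)
  show "orth_proj U a \<in> span (U \<union> W)" using orth_proj_props(1)[OF U] by (simp add: span_base)
  have "orthogonal (a - orth_proj U a) w" if "w \<in> U \<union> W" for w
    using that
  proof
    assume "w \<in> U" then show ?thesis by (rule orth_proj_props(2)[OF U])
  next
    assume "w \<in> W" then show ?thesis
      using W[of w] by (simp add: orthogonal_def inner_diff_right inner_commute[of _ w])
  qed
  then show "orthogonal (a - orth_proj U a) w" if "w \<in> span (U \<union> W)" for w
    using that orthogonal_to_span by blast
qed

theorem proposition1:
  fixes a :: "real^'n" and U :: "(real^'n) set" and r :: nat and \<rho> :: real
    and M :: "'s measure" and u :: "'s \<Rightarrow> real^'n"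
  assumes "subspace U" and "dim U = r"
    and "prob_space M" and "u \<in> borel_measurable M"
    and "uniform_on_unit_sphere U (distr M borel u)"
  shows
    "integrable M (\<lambda>\<omega>. a \<bullet> (\<rho> *\<^sub>R u \<omega>)) \<and>
     integrable M (\<lambda>\<omega>. (a \<bullet> (\<rho> *\<^sub>R u \<omega>))\<^sup>2) \<and>
     prob_space.expectation M (\<lambda>\<omega>. a \<bullet> (\<rho> *\<^sub>R u \<omega>)) = 0 \<and>
     prob_space.variance M (\<lambda>\<omega>. a \<bullet> (\<rho> *\<^sub>R u \<omega>)) = \<rho>\<^sup>2 * (norm (orth_proj U a))\<^sup>2 / real r \<and>
     sqrt (prob_space.variance M (\<lambda>\<omega>. a \<bullet> (\<rho> *\<^sub>R u \<omega>)))
       = \<bar>\<rho>\<bar> * (norm (orth_proj U a) / sqrt (real r)) \<and>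
     (\<forall>W. (\<forall>w\<in>W. orthogonal w a \<and> orthogonal w (orth_proj U a)) \<and> \<not> W \<subseteq> U \<longrightarrow>
        (let V = span (U \<union> W) in
          r < dim V \<and>
          norm (orth_proj V a) = norm (orth_proj U a) \<and>
          (orth_proj U a \<noteq> 0 \<longrightarrow>
             norm (orth_proj V a) / sqrt (real (dim V)) < norm (orth_proj U a) / sqrt (real r)) \<and>
          (\<forall>(N :: 't measure) v.
             prob_space N \<and> v \<in> borel_measurable N \<and>
             uniform_on_unit_sphere V (distr N borel v) \<and> \<rho> \<noteq> 0 \<and> orth_proj U a \<noteq> 0 \<longrightarrow>
             sqrt (prob_space.variance N (\<lambda>\<omega>. a \<bullet> (\<rho> *\<^sub>R v \<omega>)))
               < sqrt (prob_space.variance M (\<lambda>\<omega>. a \<bullet> (\<rho> *\<^sub>R u \<omega>))))))"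
proof -
  note U = assms(1) and r = assms(2)
  note m = sphere_sample_moments[OF U assms(4,5), unfolded r]
  have r0: "0 < r" using uniform_on_unit_sphere_dim_pos[OF assms(5)] r by simp
  have sd: "sqrt (\<rho>\<^sup>2 * p\<^sup>2 / d) = \<bar>\<rho>\<bar> * (\<bar>p\<bar> / sqrt d)" for p d :: real
    by (simp add: real_sqrt_mult real_sqrt_divide)
  have "let V = span (U \<union> W) in
          r < dim V \<and>
          norm (orth_proj V a) = norm (orth_proj U a) \<and>
          (orth_proj U a \<noteq> 0 \<longrightarrow>
             norm (orth_proj V a) / sqrt (real (dim V)) < norm (orth_proj U a) / sqrt (real r)) \<and>
          (\<forall>(N :: 't measure) v.
             prob_space N \<and> v \<in> borel_measurable N \<and>
             uniform_on_unit_sphere V (distr N borel v) \<and> \<rho> \<noteq> 0 \<and> orth_proj U a \<noteq> 0 \<longrightarrow>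
             sqrt (prob_space.variance N (\<lambda>\<omega>. a \<bullet> (\<rho> *\<^sub>R v \<omega>)))
               < sqrt (prob_space.variance M (\<lambda>\<omega>. a \<bullet> (\<rho> *\<^sub>R u \<omega>))))"
    if W: "\<forall>w\<in>W. orthogonal w a \<and> orthogonal w (orth_proj U a)" "\<not> W \<subseteq> U" for W
  proof -
    define V where "V = span (U \<union> W)"
    have sV: "subspace V" unfolding V_def by (rule subspace_span)
    have UV: "U \<union> W \<subseteq> V" unfolding V_def by (rule span_superset)
    \<comment> \<open>A vector of \<open>W\<close> outside \<open>U\<close> makes the inclusion
      strict, and strict inclusion of spans raises the dimension.\<close>
    have "span U \<subset> span V"
      using UV W(2) U sV by (auto simp: span_eq_iff[THEN iffD2])
    then have dV: "r < dim V" using dim_psubset r by blast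
    have pV: "orth_proj V a = orth_proj U a"
      unfolding V_def using W(1) by (intro orth_proj_span_Un[OF U]) blast
    have lt: "norm (orth_proj V a) / sqrt (real (dim V)) < norm (orth_proj U a) / sqrt (real r)"
      if "orth_proj U a \<noteq> 0"
      using that dV r0 unfolding pV by (intro divide_strict_left_mono) auto
    \<comment> \<open>By \<open>sd\<close>, each standard deviation is the absolute radius times the
      ratio compared in \<open>lt\<close>; a nonzero radius keeps the inequality strict.\<close>
    have "sqrt (prob_space.variance N (\<lambda>\<omega>. a \<bullet> (\<rho> *\<^sub>R v \<omega>)))
               < sqrt (prob_space.variance M (\<lambda>\<omega>. a \<bullet> (\<rho> *\<^sub>R u \<omega>)))"
      if "v \<in> borel_measurable N" "uniform_on_unit_sphere V (distr N borel v)"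
        "\<rho> \<noteq> 0" "orth_proj U a \<noteq> 0" for N :: "'t measure" and v
      using lt[OF that(4)] that(3)
      unfolding sphere_sample_moments(4)[OF sV that(1,2)] m(4) sd abs_norm_cancel
      by (intro mult_strict_left_mono) auto
    with dV pV lt show ?thesis unfolding Let_def V_def[symmetric] by simp
  qed
  with m show ?thesis by (simp add: sd)
qed

end
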